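(* Let $G\ge 2$ be an integer, let $\{\pi_\theta\}_{\theta\in\Theta}$ ($\Theta\subseteq\mathbb{R}^d$ open) be a parametrized family of trajectory distributions (policy), and let $R(r_K,y)$ be the list-wise ranking reward of the ranked list $r_K=r_K(\tau)$ produced by a trajectory $\tau$, with feedback $y$ fixed. Define the expected list-wise utility $J(\theta)=\mathbb{E}_{\tau\sim\pi_\theta}[R(r_K(\tau),y)]$. Let $\tau^{(1)},\dots,\tau^{(G)}$ be independent samples from $\pi_\theta$, write $r_K^{(g)}=r_K(\tau^{(g)})$, and define the gradient estimator with inclusive group-average baseline $$\nabla\hat J(\theta)=\frac1G\sum_{g=1}^{G}\bigl(R(r_K^{(g)},y)-b\bigr)\,\nabla_\theta\log\pi_\theta(\tau^{(g)}),\qquad b=\frac1G\sum_{j=1}^{G}R(r_K^{(j)},y).$$ Then $\nabla\hat J(\theta)$ is a directionally unbiased estimate of $\nabla J(\theta)$, up to the positive scaling factor $\frac{G-1}{G}$; that is, for every $\theta\in\Theta$, $$\mathbb{E}\bigl[\nabla\hat J(\theta)\bigr]=\frac{G-1}{G}\,\nabla J(\theta).$$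
   Context: A trajectory $\tau$ is an element of a measurable space $(\mathcal{T},\mu)$ (it records the whole reasoning and tool-use process of an agent for a fixed user context, candidate set and feedback $y$) and determines a final ranked top-$K$ list $r_K(\tau)$. The policy $\pi_\theta$ is a probability density with respect to $\mu$ on $\mathcal{T}$, strictly positive and differentiable in $\theta$. The reward $\tau\mapsto R(r_K(\tau),y)$ is a bounded measurable real-valued function that does not depend on $\theta$ (for example the NDCG@$K$ score of the ground-truth item $y$ in the list $r_K(\tau)$). Regularity convention: $\nabla_\theta\log\pi_\theta$ is $\pi_\theta$-integrable, and differentiation under the integral sign is allowed, i.e. $\nabla_\theta\int f\,\pi_\theta\,d\mu=\int f\,\nabla_\theta\pi_\theta\,d\mu$ for every bounded measurable $f:\mathcal{T}\to\mathbb{R}$. *)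

theory Defs
  imports "HOL-Probability.Probability"
begin

(* GDERIV is only a relation; gradient f x is its value, meaningful when f is differentiable at x. *)
definition gradient :: "('a::real_inner \<Rightarrow> real) \<Rightarrow> 'a \<Rightarrow> 'a" where
  "gradient f x = (THE D. GDERIV f x :> D)"

lemma gradient_eqI:
  assumes "GDERIV f x :> D"
  shows "gradient f x = D"
  unfolding gradient_def
proof (rule the_equality)
  fix D' assume "GDERIV f x :> D'"
  with assms have "(\<lambda>h. inner h D') = (\<lambda>h. inner h D)"
    unfolding gderiv_def by (rule has_derivative_unique[rotated])
  then have "inner (D' - D) D' = inner (D' - D) D"
    by (rule fun_cong)
  then have "inner (D' - D) (D' - D) = 0"
    by (simp add: inner_diff_right)
  then show "D' = D" by simp
qed (rule assms)

(* In all definitions below, \<pi> \<theta> is the density of the policy with respect to \<mu>,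
   and r K t is the ranked top-K list determined by the trajectory t. *)

definition trajectory_distribution ::
  "'t measure \<Rightarrow> ('p \<Rightarrow> 't \<Rightarrow> real) \<Rightarrow> 'p \<Rightarrow> 't measure" where
  "trajectory_distribution \<mu> \<pi> \<theta> = density \<mu> (\<lambda>t. ennreal (\<pi> \<theta> t))"

definition expected_utility ::
  "'t measure \<Rightarrow> ('p \<Rightarrow> 't \<Rightarrow> real) \<Rightarrow> (nat \<Rightarrow> 't \<Rightarrow> 'i list) \<Rightarrow> nat \<Rightarrow>
   ('i list \<Rightarrow> 'y \<Rightarrow> real) \<Rightarrow> 'y \<Rightarrow> 'p \<Rightarrow> real" where
  "expected_utility \<mu> \<pi> r K R y \<theta> =
     (LINT t | trajectory_distribution \<mu> \<pi> \<theta>. R (r K t) y)"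

definition score :: "('p::real_inner \<Rightarrow> 't \<Rightarrow> real) \<Rightarrow> 'p \<Rightarrow> 't \<Rightarrow> 'p" where
  "score \<pi> \<theta> t = gradient (\<lambda>\<theta>'. ln (\<pi> \<theta>' t)) \<theta>"

(* The inclusive baseline: the average runs over the whole group, including the sample it is
   subtracted from. *)
definition group_baseline ::
  "(nat \<Rightarrow> 't \<Rightarrow> 'i list) \<Rightarrow> nat \<Rightarrow> ('i list \<Rightarrow> 'y \<Rightarrow> real) \<Rightarrow> 'y \<Rightarrow>
   nat \<Rightarrow> (nat \<Rightarrow> 't) \<Rightarrow> real" where
  "group_baseline r K R y G ts = (1 / real G) * (\<Sum>j = 1..G. R (r K (ts j)) y)"

definition gradient_estimator ::
  "('p::real_inner \<Rightarrow> 't \<Rightarrow> real) \<Rightarrow> (nat \<Rightarrow> 't \<Rightarrow> 'i list) \<Rightarrow> nat \<Rightarrow>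
   ('i list \<Rightarrow> 'y \<Rightarrow> real) \<Rightarrow> 'y \<Rightarrow> nat \<Rightarrow> 'p \<Rightarrow> (nat \<Rightarrow> 't) \<Rightarrow> 'p" where
  "gradient_estimator \<pi> r K R y G \<theta> ts =
     (1 / real G) *\<^sub>R
       (\<Sum>g = 1..G. (R (r K (ts g)) y - group_baseline r K R y G ts) *\<^sub>R score \<pi> \<theta> (ts g))"

end

theory Submission
  imports Defs
begin

text \<open>
  The log-derivative trick turns a derivative of an integral into
  \<open>\<nabla> E f = E (f \<cdot> score)\<close>; the choice \<open>f = 1\<close> shows that the score has mean zero. Hence in the
  estimator every cross term \<open>R(\<tau>\<^sub>j) \<cdot> score(\<tau>\<^sub>g)\<close> with \<open>j \<noteq> g\<close> vanishes by independence, and the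
  inclusive baseline removes exactly the share \<open>1 / G\<close> of each diagonal term.
\<close>

text \<open>Riesz representation in finite dimension: the derivative is a linear functional, and
  applying its adjoint to \<open>1\<close> gives the vector that represents it.\<close>

lemma differentiable_imp_GDERIV:
  fixes f :: "'a::euclidean_space \<Rightarrow> real"
  assumes "f differentiable (at x)"
  shows "GDERIV f x :> gradient f x"
proof -
  obtain f' where f': "(f has_derivative f') (at x)"
    using assms unfolding differentiable_def by blast
  interpret f': bounded_linear f'
    using f' by (rule has_derivative_bounded_linear)
  have "f' h = h \<bullet> adjoint f' 1" for h
    using adjoint_works[of f' h 1] by (simp add: f'.linear_axioms)
  then have "f' = (\<lambda>h. h \<bullet> adjoint f' 1)" by blast
  then have "GDERIV f x :> adjoint f' 1"
    using f' unfolding gderiv_def by metis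
  then show ?thesis by (simp add: gradient_eqI)
qed

text \<open>Needed because the identities between parametrized integrals are available only for
  parameters in \<Theta>; openness makes agreement there enough to transfer a gradient.\<close>

lemma GDERIV_cong_open:
  assumes "open S" "x \<in> S" "\<And>z. z \<in> S \<Longrightarrow> f z = g z" "GDERIV f x :> D"
  shows "GDERIV g x :> D"
  using has_derivative_transform_within_open[OF assms(4)[unfolded gderiv_def] assms(1,2)] assms(3)
  unfolding gderiv_def by blast

text \<open>The chain rule for \<open>ln\<close> produces the factor
  \<open>1 / \<pi> \<theta> t\<close>, which the weight \<open>\<pi> \<theta> t\<close> cancels. The
  multiplied form is the one that appears once an integral against the policy is written over
  \<mu>.\<close>

lemma scaleR_score:
  fixes \<pi> :: "'p::euclidean_space \<Rightarrow> 't \<Rightarrow> real"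
  assumes pos: "\<pi> \<theta> t > 0" and diff: "(\<lambda>\<theta>'. \<pi> \<theta>' t) differentiable (at \<theta>)"
  shows "\<pi> \<theta> t *\<^sub>R score \<pi> \<theta> t = gradient (\<lambda>\<theta>'. \<pi> \<theta>' t) \<theta>"
proof -
  have "DERIV ln (\<pi> \<theta> t) :> 1 / \<pi> \<theta> t"
    using pos by (rule DERIV_ln_divide)
  then have "GDERIV (\<lambda>\<theta>'. ln (\<pi> \<theta>' t)) \<theta> :> (1 / \<pi> \<theta> t) *\<^sub>R gradient (\<lambda>\<theta>'. \<pi> \<theta>' t) \<theta>"
    by (rule GDERIV_DERIV_compose[OF differentiable_imp_GDERIV[OF diff]])
  then have "score \<pi> \<theta> t = (1 / \<pi> \<theta> t) *\<^sub>R gradient (\<lambda>\<theta>'. \<pi> \<theta>' t) \<theta>"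
    unfolding score_def by (rule gradient_eqI)
  then show ?thesis using pos by simp
qed

text \<open>The singletons \<open>{i}\<close> and \<open>{j}\<close> are disjoint blocks of indices,
  so the restricted families are independent; evaluating each at its only index recovers the two
  variables.\<close>

lemma (in prob_space) indep_vars_imp_indep_var:
  assumes "indep_vars M' X I" "i \<in> I" "j \<in> I" "i \<noteq> j"
  shows "indep_var (M' i) (X i) (M' j) (X j)"
proof -
  have "indep_var (M' i) ((\<lambda>f. f i) \<circ> (\<lambda>\<omega>. restrict (\<lambda>k. X k \<omega>) {i}))
      (M' j) ((\<lambda>f. f j) \<circ> (\<lambda>\<omega>. restrict (\<lambda>k. X k \<omega>) {j}))"
    using assms by (intro indep_var_compose[OF indep_var_restrict[OF assms(1)]]) auto
  then show ?thesis by (simp add: comp_def)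
qed

text \<open>The scalar product rule for independent variables is applied to each coordinate of
  \<open>h\<close>, and the coordinates are reassembled over \<open>Basis\<close>.\<close>

lemma (in prob_space) indep_var_has_bochner_integral_scaleR:
  fixes f :: "'b \<Rightarrow> real" and h :: "'b \<Rightarrow> 'c::euclidean_space"
  assumes indep: "indep_var S X T Y"
    and [measurable]: "f \<in> borel_measurable S" "h \<in> borel_measurable T"
    and f: "integrable M (\<lambda>\<omega>. f (X \<omega>))" and h: "integrable M (\<lambda>\<omega>. h (Y \<omega>))"
  shows "has_bochner_integral M (\<lambda>\<omega>. f (X \<omega>) *\<^sub>R h (Y \<omega>))
    (expectation (\<lambda>\<omega>. f (X \<omega>)) *\<^sub>R expectation (\<lambda>\<omega>. h (Y \<omega>)))"
proof -
  let ?f = "\<lambda>\<omega>. f (X \<omega>)" and ?h = "\<lambda>\<omega>. h (Y \<omega>)"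
  have "has_bochner_integral M (\<lambda>\<omega>. (?f \<omega> * (?h \<omega> \<bullet> b)) *\<^sub>R b)
      ((expectation ?f * (expectation ?h \<bullet> b)) *\<^sub>R b)" for b
  proof -
    have indep_b: "indep_var borel ?f borel (\<lambda>\<omega>. ?h \<omega> \<bullet> b)"
      using indep_var_compose[OF indep, of f borel "\<lambda>y. h y \<bullet> b" borel] by (simp add: comp_def)
    have h_b: "integrable M (\<lambda>\<omega>. ?h \<omega> \<bullet> b)"
      using h by (rule integrable_inner_left)
    have "has_bochner_integral M (\<lambda>\<omega>. ?f \<omega> * (?h \<omega> \<bullet> b))
        (expectation ?f * (expectation ?h \<bullet> b))"
      using indep_var_integrable[OF indep_b f h_b] indep_var_lebesgue_integral[OF indep_b f h_b] h
      by (simp add: has_bochner_integral_iff)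
    then show ?thesis by (rule has_bochner_integral_scaleR_left)
  qed
  then have "has_bochner_integral M (\<lambda>\<omega>. \<Sum>b\<in>Basis. (?f \<omega> * (?h \<omega> \<bullet> b)) *\<^sub>R b)
      (\<Sum>b\<in>Basis. (expectation ?f * (expectation ?h \<bullet> b)) *\<^sub>R b)"
    by (rule has_bochner_integral_sum)
  moreover have "(\<Sum>b\<in>Basis. (c * (v \<bullet> b)) *\<^sub>R b) = c *\<^sub>R v" for c and v :: 'c
    by (simp add: euclidean_representation flip: scaleR_scaleR scaleR_sum_right)
  ultimately show ?thesis by simp
qed

theorem proposition1:
  fixes \<mu> :: "'t measure"
    and \<Theta> :: "(real ^ 'd) set"
    and \<pi> :: "real ^ 'd \<Rightarrow> 't \<Rightarrow> real"
    and r :: "nat \<Rightarrow> 't \<Rightarrow> 'i list" and K :: nat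
    and R :: "'i list \<Rightarrow> 'y \<Rightarrow> real" and y :: 'y
    and G :: nat
    and \<theta> :: "real ^ 'd"
    and M :: "'w measure"
    and \<tau> :: "nat \<Rightarrow> 'w \<Rightarrow> 't"
  assumes G: "G \<ge> 2"
    and \<Theta>_open: "open \<Theta>"
    and policy_measurable: "\<And>\<theta>. \<theta> \<in> \<Theta> \<Longrightarrow> \<pi> \<theta> \<in> borel_measurable \<mu>"
    and policy_pos: "\<And>\<theta> t. \<theta> \<in> \<Theta> \<Longrightarrow> t \<in> space \<mu> \<Longrightarrow> \<pi> \<theta> t > 0"
    and policy_prob: "\<And>\<theta>. \<theta> \<in> \<Theta> \<Longrightarrow> prob_space (trajectory_distribution \<mu> \<pi> \<theta>)"
    and policy_differentiable:
      "\<And>\<theta> t. \<theta> \<in> \<Theta> \<Longrightarrow> t \<in> space \<mu> \<Longrightarrow> (\<lambda>\<theta>'. \<pi> \<theta>' t) differentiable (at \<theta>)"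
    and reward_measurable: "(\<lambda>t. R (r K t) y) \<in> borel_measurable \<mu>"
    and reward_bounded: "\<exists>B. \<forall>t \<in> space \<mu>. \<bar>R (r K t) y\<bar> \<le> B"
    and score_integrable:
      "\<And>\<theta>. \<theta> \<in> \<Theta> \<Longrightarrow> integrable (trajectory_distribution \<mu> \<pi> \<theta>) (score \<pi> \<theta>)"
    and diff_under_integral:
      "\<And>f \<theta>. f \<in> borel_measurable \<mu> \<Longrightarrow> \<exists>B. \<forall>t \<in> space \<mu>. \<bar>f t\<bar> \<le> B \<Longrightarrow> \<theta> \<in> \<Theta> \<Longrightarrow>
         GDERIV (\<lambda>\<theta>'. LINT t | \<mu>. f t * \<pi> \<theta>' t) \<theta> :>
           (LINT t | \<mu>. f t *\<^sub>R gradient (\<lambda>\<theta>'. \<pi> \<theta>' t) \<theta>)"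
    and \<theta>: "\<theta> \<in> \<Theta>"
    and sample_space: "prob_space M"
    and samples_indep: "prob_space.indep_vars M (\<lambda>_. \<mu>) \<tau> {1..G}"
    and samples_distributed:
      "\<And>g. g \<in> {1..G} \<Longrightarrow> distributed M \<mu> (\<tau> g) (\<lambda>t. ennreal (\<pi> \<theta> t))"
  shows "expected_utility \<mu> \<pi> r K R y differentiable (at \<theta>) \<and>
     integrable M (\<lambda>\<omega>. gradient_estimator \<pi> r K R y G \<theta> (\<lambda>g. \<tau> g \<omega>)) \<and>
     (real G - 1) / real G > 0 \<and>
     prob_space.expectation M (\<lambda>\<omega>. gradient_estimator \<pi> r K R y G \<theta> (\<lambda>g. \<tau> g \<omega>)) =
       ((real G - 1) / real G) *\<^sub>R gradient (expected_utility \<mu> \<pi> r K R y) \<theta>"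
proof -
  interpret M: prob_space M by (rule sample_space)
  let ?D = "trajectory_distribution \<mu> \<pi>"
  let ?rew = "\<lambda>t. R (r K t) y"
  let ?J = "expected_utility \<mu> \<pi> r K R y"
  let ?S = "score \<pi> \<theta>"

  have sets_D [measurable_cong]: "sets (?D \<theta>) = sets \<mu>"
    by (simp add: trajectory_distribution_def)
  have [measurable]: "?rew \<in> borel_measurable \<mu>" by (rule reward_measurable)
  \<comment> \<open>Measurability of the score is extracted from its integrability; passing to a
    density leaves the sigma-algebra unchanged.\<close>
  have S_meas [measurable]: "?S \<in> borel_measurable \<mu>"
    using borel_measurable_integrable[OF score_integrable[OF \<theta>]]
      measurable_cong_sets[OF sets_D refl] by blast
  interpret D: prob_space "?D \<theta>" by (rule policy_prob[OF \<theta>])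

  \<comment> \<open>Stated for every parameter in \<Theta>, since differentiation at \<theta>
    involves nearby parameters, and for Banach-valued \<open>f\<close>, to cover both rewards and
    scores.\<close>
  have lint_D: "(LINT t | ?D \<theta>'. f t) = (LINT t | \<mu>. \<pi> \<theta>' t *\<^sub>R f t)"
    if "\<theta>' \<in> \<Theta>" "f \<in> borel_measurable \<mu>"
    for \<theta>' and f :: "'t \<Rightarrow> 'b::{banach, second_countable_topology}"
    unfolding trajectory_distribution_def using that policy_measurable policy_pos
    by (intro integral_density AE_I2) (auto intro: less_imp_le)

  have score_gradient: "GDERIV (\<lambda>\<theta>'. LINT t | ?D \<theta>'. f t) \<theta> :> (LINT t | ?D \<theta>. f t *\<^sub>R ?S t)"
    if f [measurable]: "f \<in> borel_measurable \<mu>" and bnd: "\<exists>B. \<forall>t\<in>space \<mu>. \<bar>f t\<bar> \<le> B" for f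
  proof -
    have "(LINT t | ?D \<theta>. f t *\<^sub>R ?S t) = (LINT t | \<mu>. f t *\<^sub>R gradient (\<lambda>\<theta>'. \<pi> \<theta>' t) \<theta>)"
    proof (subst lint_D[OF \<theta>])
      show "(LINT t | \<mu>. \<pi> \<theta> t *\<^sub>R f t *\<^sub>R ?S t)
          = (LINT t | \<mu>. f t *\<^sub>R gradient (\<lambda>\<theta>'. \<pi> \<theta>' t) \<theta>)"
        using policy_pos[OF \<theta>] policy_differentiable[OF \<theta>]
        by (intro Bochner_Integration.integral_cong refl)
          (simp only: scaleR_left_commute[of "\<pi> \<theta> _"] scaleR_score)
    qed measurable
    then have "GDERIV (\<lambda>\<theta>'. LINT t | \<mu>. f t * \<pi> \<theta>' t) \<theta> :> (LINT t | ?D \<theta>. f t *\<^sub>R ?S t)"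
      using diff_under_integral[OF f bnd \<theta>] by simp
    then show ?thesis
      by (rule GDERIV_cong_open[OF \<Theta>_open \<theta>, rotated]) (simp add: lint_D[OF _ f] mult.commute)
  qed

  have J_gderiv: "GDERIV ?J \<theta> :> (LINT t | ?D \<theta>. ?rew t *\<^sub>R ?S t)"
    using score_gradient[OF reward_measurable reward_bounded]
    unfolding expected_utility_def[abs_def] .
  note J_gradient = gradient_eqI[OF J_gderiv]

  have score_mean: "(LINT t | ?D \<theta>. ?S t) = 0"
  proof -
    have "GDERIV (\<lambda>\<theta>'. LINT t | ?D \<theta>'. (1::real)) \<theta> :> (LINT t | ?D \<theta>. ?S t)"
      using score_gradient[of "\<lambda>_. 1"] by auto
    \<comment> \<open>The total mass is 1 throughout \<Theta>, so its gradient vanishes; uniqueness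
      of gradients then forces the mean score to be 0.\<close>
    moreover have "GDERIV (\<lambda>\<theta>'. LINT t | ?D \<theta>'. (1::real)) \<theta> :> 0"
      by (rule GDERIV_cong_open[OF \<Theta>_open \<theta> _ GDERIV_const[of 1]])
        (simp add: prob_space.prob_space[OF policy_prob])
    ultimately show ?thesis by (metis gradient_eqI)
  qed

  obtain B where B: "\<And>t. t \<in> space \<mu> \<Longrightarrow> \<bar>?rew t\<bar> \<le> B"
    using reward_bounded by blast
  have space_D: "space (?D \<theta>) = space \<mu>"
    using sets_D by (rule sets_eq_imp_space_eq)
  have rew_int: "integrable (?D \<theta>) ?rew"
    by (rule D.integrable_const_bound[where B = B]) (auto simp: space_D B)
  have rew_score_int: "integrable (?D \<theta>) (\<lambda>t. ?rew t *\<^sub>R ?S t)"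
  proof (rule Bochner_Integration.integrable_bound)
    show "integrable (?D \<theta>) (\<lambda>t. B *\<^sub>R ?S t)"
      using score_integrable[OF \<theta>] by simp
    \<comment> \<open>The bound \<open>B\<close> on the reward makes a constant multiple of the
      score a dominating function.\<close>
    show "AE t in ?D \<theta>. norm (?rew t *\<^sub>R ?S t) \<le> norm (B *\<^sub>R ?S t)"
      using B by (intro AE_I2) (fastforce simp: space_D intro!: mult_right_mono)
  qed measurable

  have \<tau>_meas: "\<tau> g \<in> measurable M \<mu>" if "g \<in> {1..G}" for g
    using samples_distributed[OF that] by (rule distributed_measurable)
  \<comment> \<open>Each sample has law \<open>?D \<theta>\<close>, so integrability and integrals
    transfer to \<open>M\<close> by change of variables.\<close>
  have sample: "has_bochner_integral M (\<lambda>\<omega>. f (\<tau> g \<omega>)) (LINT t | ?D \<theta>. f t)"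
    if g: "g \<in> {1..G}" and f: "integrable (?D \<theta>) f"
    for g and f :: "'t \<Rightarrow> 'b::{banach, second_countable_topology}"
  proof -
    have distr: "distr M \<mu> (\<tau> g) = ?D \<theta>"
      using distributed_distr_eq_density[OF samples_distributed[OF g]]
      by (simp add: trajectory_distribution_def)
    have f_meas: "f \<in> borel_measurable \<mu>"
      using borel_measurable_integrable[OF f] measurable_cong_sets[OF sets_D refl] by blast
    show ?thesis
      using f integrable_distr_eq[OF \<tau>_meas[OF g] f_meas] integral_distr[OF \<tau>_meas[OF g] f_meas]
      by (simp add: distr has_bochner_integral_iff)
  qed

  have cross: "has_bochner_integral M (\<lambda>\<omega>. ?rew (\<tau> j \<omega>) *\<^sub>R ?S (\<tau> g \<omega>))
      (if j = g then gradient ?J \<theta> else 0)" if j: "j \<in> {1..G}" and g: "g \<in> {1..G}" for j g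
  proof (cases "j = g")
    case True
    then show ?thesis using sample[OF g rew_score_int] by (simp add: J_gradient)
  next
    case False
    have "M.indep_var \<mu> (\<tau> j) \<mu> (\<tau> g)"
      by (rule M.indep_vars_imp_indep_var[OF samples_indep j g False])
    from M.indep_var_has_bochner_integral_scaleR[OF this, of ?rew ?S]
    have "has_bochner_integral M (\<lambda>\<omega>. ?rew (\<tau> j \<omega>) *\<^sub>R ?S (\<tau> g \<omega>))
        (M.expectation (\<lambda>\<omega>. ?rew (\<tau> j \<omega>)) *\<^sub>R M.expectation (\<lambda>\<omega>. ?S (\<tau> g \<omega>)))"
      using sample[OF j rew_int] sample[OF g score_integrable[OF \<theta>]]
      by (simp add: has_bochner_integral_iff)
    moreover have "M.expectation (\<lambda>\<omega>. ?S (\<tau> g \<omega>)) = 0"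
      using sample[OF g score_integrable[OF \<theta>]] score_mean
      by (simp add: has_bochner_integral_iff)
    ultimately show ?thesis using False by simp
  qed

  let ?est = "\<lambda>\<omega>. gradient_estimator \<pi> r K R y G \<theta> (\<lambda>g. \<tau> g \<omega>)"
  \<comment> \<open>The baseline is distributed over the score, leaving only products covered by
    \<open>cross\<close>. The trivial test \<open>g = g\<close> is kept so that the diagonal term
    matches \<open>cross\<close> literally.\<close>
  have "has_bochner_integral M
      (\<lambda>\<omega>. (1 / real G) *\<^sub>R (\<Sum>g = 1..G. ?rew (\<tau> g \<omega>) *\<^sub>R ?S (\<tau> g \<omega>)
        - (1 / real G) *\<^sub>R (\<Sum>j = 1..G. ?rew (\<tau> j \<omega>) *\<^sub>R ?S (\<tau> g \<omega>))))
      ((1 / real G) *\<^sub>R (\<Sum>g = 1..G. (if g = g then gradient ?J \<theta> else 0)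
        - (1 / real G) *\<^sub>R (\<Sum>j = 1..G. if j = g then gradient ?J \<theta> else 0)))"
    by (intro has_bochner_integral_scaleR_right has_bochner_integral_sum
        has_bochner_integral_diff cross)
  moreover have "(\<lambda>\<omega>. (1 / real G) *\<^sub>R (\<Sum>g = 1..G. ?rew (\<tau> g \<omega>) *\<^sub>R ?S (\<tau> g \<omega>)
        - (1 / real G) *\<^sub>R (\<Sum>j = 1..G. ?rew (\<tau> j \<omega>) *\<^sub>R ?S (\<tau> g \<omega>)))) = ?est"
    by (simp add: gradient_estimator_def group_baseline_def scaleR_left_diff_distrib
        flip: scaleR_sum_left)
  moreover have "(1 / real G) *\<^sub>R (\<Sum>g = 1..G. (if g = g then gradient ?J \<theta> else 0)
        - (1 / real G) *\<^sub>R (\<Sum>j = 1..G. if j = g then gradient ?J \<theta> else 0))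
      = ((real G - 1) / real G) *\<^sub>R gradient ?J \<theta>"
  proof -
    \<comment> \<open>Only \<open>j = g\<close> survives in the inner sum, so the average runs over
      \<open>G\<close> identical summands.\<close>
    have "(1 / real G) *\<^sub>R (\<Sum>g = 1..G. gradient ?J \<theta> - (1 / real G) *\<^sub>R gradient ?J \<theta>)
        = (1 - 1 / real G) *\<^sub>R gradient ?J \<theta>"
      using G by (simp add: sum_constant_scaleR scaleR_left_diff_distrib
          del: sum_constant sum_subtractf)
    then show ?thesis using G by (simp add: diff_divide_distrib)
  qed
  ultimately have "has_bochner_integral M ?est (((real G - 1) / real G) *\<^sub>R gradient ?J \<theta>)"
    by simp
  \<comment> \<open>As \<open>gradient\<close> is a definite description, this is what makes the
    right-hand side of the identity a genuine gradient.\<close>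
  moreover have "?J differentiable (at \<theta>)"
    using J_gderiv unfolding gderiv_def differentiable_def by blast
  ultimately show ?thesis
    using G by (simp add: has_bochner_integral_iff)
qed

end
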